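(* Let $W\in\{0,1\}^{n\times p}$ have at most $t$ zero entries per column. For any rank-$k$ matrix $L\in\mathbb{R}^{n\times p}$ and $0\le\epsilon\le1$, there is a subset of row indices $\mathcal S\subset[n]$ with $|\mathcal S|\le\frac{tk}{\epsilon}$ such that, letting $\bar W=W([n]\setminus\mathcal S,[p])$ and $\bar L=L([n]\setminus\mathcal S,[p])$, $$\|\bar L\circ(1-\bar W)\|_F^2\le\frac{\epsilon}{1-\epsilon}\|L\circ W\|_F^2.$$
   Context: For a matrix $M$ and index sets $R,C$, $M(R,C)$ is the submatrix with rows in $R$ and columns in $C$. $\circ$ is the entrywise product and $1-\bar W$ has entries $1-\bar W_{i,j}$. *)

theory Defs
  imports
    "HOL-Library.Extended_Real"
    "Jordan_Normal_Form.DL_Rank"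
    "Jordan_Normal_Form.DL_Submatrix"
begin

definition frob_norm :: "real mat \<Rightarrow> real" where
  "frob_norm A = sqrt (\<Sum>i<dim_row A. \<Sum>j<dim_col A. (A $$ (i, j))\<^sup>2)"

(* Entrywise product; only meant for two matrices of equal dimensions. *)
definition entrywise_prod :: "real mat \<Rightarrow> real mat \<Rightarrow> real mat" where
  "entrywise_prod A B = mat (dim_row A) (dim_col A) (\<lambda>(i, j). A $$ (i, j) * B $$ (i, j))"

definition one_minus_mat :: "real mat \<Rightarrow> real mat" where
  "one_minus_mat A = map_mat (\<lambda>x. 1 - x) A"

end

(* Reweight the rows by w in [0,1]^n so that every entry of a column x satisfies
   w_i x_i^2 <= u * (sum_l w_l x_l^2) with u = \<epsilon> / t, and let S be the set of rows with w_i < 1.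
   Summing over the at most t zero positions Z of W in that column gives
   (1 - \<epsilon>) * (sum_{i in Z} w_i x_i^2) <= \<epsilon> * (sum_{i not in Z} w_i x_i^2), and w_i = 1 outside S.
   If w is maximal, each row of S attains equality for some column, so its leverage score in the
   reweighted matrix is at least u; the leverage scores sum to at most k, hence |S| <= k / u.
   A ridge \<delta> > 0, removed at the end by letting \<delta> tend to 0, keeps the reweighted inner product
   positive definite when weights vanish. *)
theory Submission
  imports Defs "HOL-Analysis.Convex"
begin

section \<open>Orthonormal systems and leverage scores for weighted inner products\<close>

text \<open>Gram-Schmidt for the inner product on functions on \<open>I\<close> with weights
  \<open>c\<close>, by induction on \<open>B\<close>. The family \<open>v\<close> may be dependent:
  a vector with zero residual adds nothing to the system, hence only
  \<open>m \<le> card B\<close>.\<close>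

lemma weighted_gram_schmidt:
  fixes c :: "'i \<Rightarrow> real" and v :: "'b \<Rightarrow> 'i \<Rightarrow> real"
  assumes "finite I" and c: "\<And>i. i \<in> I \<Longrightarrow> 0 < c i" and "finite B"
  shows "\<exists>m e. m \<le> card B
    \<and> (\<forall>r<m. \<forall>s<m. (\<Sum>i\<in>I. c i * (e r i * e s i)) = (if r = s then 1 else 0))
    \<and> (\<forall>b\<in>B. \<exists>a. \<forall>i\<in>I. v b i = (\<Sum>r<m. a r * e (r::nat) i))"
  using \<open>finite B\<close>
proof (induction B)
  case empty
  then show ?case by (intro exI[of _ "0::nat"]) auto
next
  case (insert b B)
  then obtain m and e :: "nat \<Rightarrow> 'i \<Rightarrow> real" where m: "m \<le> card B"
    and on: "\<And>r s. r < m \<Longrightarrow> s < m \<Longrightarrow> (\<Sum>i\<in>I. c i * (e r i * e s i)) = (if r = s then 1 else 0)"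
    and sp: "\<And>b. b \<in> B \<Longrightarrow> \<exists>a. \<forall>i\<in>I. v b i = (\<Sum>r<m. a r * e r i)"
    by blast
  \<comment> \<open>\<open>a\<close> holds the Fourier coefficients of \<open>v b\<close>, and
    \<open>res\<close> is the part of \<open>v b\<close> orthogonal to the current system.\<close>
  define a where "a r = (\<Sum>i\<in>I. c i * (v b i * e r i))" for r
  define res where "res i = v b i - (\<Sum>r<m. a r * e r i)" for i
  define N where "N = (\<Sum>i\<in>I. c i * (res i * res i))"
  have orth: "(\<Sum>i\<in>I. c i * (res i * e s i)) = 0" if "s < m" for s
  proof -
    have "(\<Sum>i\<in>I. c i * (res i * e s i))
        = (\<Sum>i\<in>I. c i * (v b i * e s i)) - (\<Sum>i\<in>I. \<Sum>r<m. a r * (c i * (e r i * e s i)))"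
      by (simp add: res_def algebra_simps sum_subtractf sum_distrib_left sum_distrib_right)
    also have "(\<Sum>i\<in>I. \<Sum>r<m. a r * (c i * (e r i * e s i)))
        = (\<Sum>r<m. a r * (\<Sum>i\<in>I. c i * (e r i * e s i)))"
      by (subst sum.swap) (simp add: sum_distrib_left)
    also have "\<dots> = (\<Sum>r<m. if r = s then a s else 0)"
      by (rule sum.cong) (auto simp: on that)
    also have "\<dots> = a s" using that by simp
    finally show ?thesis by (simp add: a_def)
  qed
  have card: "card (insert b B) = Suc (card B)" using insert.hyps by simp
  have vb: "v b i = (\<Sum>r<m. a r * e r i) + res i" for i by (simp add: res_def)
  show ?case
  proof (cases "N = 0")
    case True
    \<comment> \<open>All weights are positive, so a residual of norm zero vanishes pointwise on
      \<open>I\<close> and the old system already spans \<open>v b\<close>.\<close>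
    have "\<forall>i\<in>I. c i * (res i * res i) = 0"
      using True unfolding N_def
      by (subst (asm) sum_nonneg_eq_0_iff[OF \<open>finite I\<close>])
        (auto intro!: mult_nonneg_nonneg[OF less_imp_le[OF c] zero_le_square])
    then have "res i = 0" if "i \<in> I" for i
      using c[OF that] that by fastforce
    then have "\<forall>i\<in>I. v b i = (\<Sum>r<m. a r * e r i)" by (simp add: vb)
    then show ?thesis using m on sp card by (intro exI[of _ m] exI[of _ e]) auto
  next
    case False
    moreover have "0 \<le> N"
      unfolding N_def
      by (rule sum_nonneg) (rule mult_nonneg_nonneg[OF less_imp_le[OF c] zero_le_square])
    ultimately have N: "0 < N" by simp
    \<comment> \<open>The normalized residual becomes the new member, at index
      \<open>m\<close>.\<close>
    define e' where "e' = e(m := \<lambda>i. res i / sqrt N)"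
    have "(\<Sum>i\<in>I. c i * (e' m i * e' m i)) = (\<Sum>i\<in>I. c i * (res i * res i)) / N"
      using N by (simp add: e'_def sum_divide_distrib)
    then have mm: "(\<Sum>i\<in>I. c i * (e' m i * e' m i)) = 1"
      using N by (simp add: N_def)
    have ms: "(\<Sum>i\<in>I. c i * (e' m i * e' s i)) = 0" if "s < m" for s
    proof -
      have "(\<Sum>i\<in>I. c i * (e' m i * e' s i)) = (\<Sum>i\<in>I. c i * (res i * e s i)) / sqrt N"
        using that by (simp add: e'_def sum_divide_distrib)
      then show ?thesis using orth[OF that] by simp
    qed
    have sm: "(\<Sum>i\<in>I. c i * (e' s i * e' m i)) = 0" if "s < m" for s
      using ms[OF that] by (simp add: mult.commute)
    have rs: "(\<Sum>i\<in>I. c i * (e' r i * e' s i)) = (if r = s then 1 else 0)"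
      if "r < m" "s < m" for r s
      using that on[OF that] by (simp add: e'_def)
    have sp': "\<exists>a. \<forall>i\<in>I. v x i = (\<Sum>r<Suc m. a r * e' r i)" if x: "x \<in> insert b B" for x
    proof (cases "x = b")
      case True
      have "\<forall>i\<in>I. v b i = (\<Sum>r<Suc m. (a(m := sqrt N)) r * e' r i)"
        using N by (simp add: vb e'_def)
      then show ?thesis using True by blast
    next
      case False
      then obtain a where "\<forall>i\<in>I. v x i = (\<Sum>r<m. a r * e r i)" using sp x by blast
      then have "\<forall>i\<in>I. v x i = (\<Sum>r<Suc m. (a(m := 0)) r * e' r i)"
        by (simp add: e'_def)
      then show ?thesis by blast
    qed
    have "\<forall>r<Suc m. \<forall>s<Suc m. (\<Sum>i\<in>I. c i * (e' r i * e' s i)) = (if r = s then 1 else 0)"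
      by (auto simp: less_Suc_eq mm ms sm rs)
    then show ?thesis using m card sp'
      by (intro exI[of _ "Suc m"] exI[of _ e'] conjI) auto
  qed
qed

text \<open>With an orthonormal basis \<open>e\<close> of the span, \<tau> \<open>i\<close> is
  \<open>c i\<close> times the squared length of row \<open>i\<close> of \<open>e\<close>.
  Cauchy-Schwarz bounds each entry of a vector in the span, and summing over \<open>i\<close> adds
  up the unit norms of the \<open>m\<close> basis vectors.\<close>

lemma leverage_scores:
  fixes c :: "'i \<Rightarrow> real" and v :: "'b \<Rightarrow> 'i \<Rightarrow> real"
  assumes "finite I" and c: "\<And>i. i \<in> I \<Longrightarrow> 0 < c i" and "finite B"
  obtains \<tau> :: "'i \<Rightarrow> real"
  where "\<And>x a i. (\<And>i. i \<in> I \<Longrightarrow> x i = (\<Sum>b\<in>B. a b * v b i)) \<Longrightarrow> i \<in> I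
      \<Longrightarrow> c i * (x i)\<^sup>2 \<le> \<tau> i * (\<Sum>l\<in>I. c l * (x l)\<^sup>2)"
    and "\<And>i. i \<in> I \<Longrightarrow> 0 \<le> \<tau> i"
    and "(\<Sum>i\<in>I. \<tau> i) \<le> real (card B)"
proof -
  obtain m and e :: "nat \<Rightarrow> 'i \<Rightarrow> real" where m: "m \<le> card B"
    and on: "\<And>r s. r < m \<Longrightarrow> s < m \<Longrightarrow> (\<Sum>i\<in>I. c i * (e r i * e s i)) = (if r = s then 1 else 0)"
    and sp: "\<forall>b\<in>B. \<exists>a. \<forall>i\<in>I. v b i = (\<Sum>r<m. a r * e r i)"
    using weighted_gram_schmidt[of I c B v] assms by blast
  from bchoice[OF sp] obtain A
    where A: "\<And>b i. b \<in> B \<Longrightarrow> i \<in> I \<Longrightarrow> v b i = (\<Sum>r<m. A b r * e r i)" by blast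
  define \<tau> where "\<tau> i = c i * (\<Sum>r<m. (e r i)\<^sup>2)" for i
  show thesis
  proof
    fix x a i assume x: "\<And>i. i \<in> I \<Longrightarrow> x i = (\<Sum>b\<in>B. a b * v b i)" and i: "i \<in> I"
    define \<beta> where "\<beta> r = (\<Sum>b\<in>B. a b * A b r)" for r
    have xe: "x i = (\<Sum>r<m. \<beta> r * e r i)" if i: "i \<in> I" for i
    proof -
      have "x i = (\<Sum>b\<in>B. \<Sum>r<m. a b * A b r * e r i)"
        by (simp add: x A i sum_distrib_left mult.assoc)
      also have "\<dots> = (\<Sum>r<m. \<beta> r * e r i)"
        by (subst sum.swap) (simp add: \<beta>_def sum_distrib_right)
      finally show ?thesis .
    qed
    \<comment> \<open>Parseval: by orthonormality, the weighted squared norm of \<open>x\<close> is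
      the sum of its squared coefficients \<beta>.\<close>
    have "(\<Sum>l\<in>I. c l * (x l)\<^sup>2)
        = (\<Sum>l\<in>I. \<Sum>r<m. \<Sum>s<m. \<beta> r * \<beta> s * (c l * (e r l * e s l)))"
      by (intro sum.cong refl)
        (simp add: xe power2_eq_square sum_product sum_distrib_left mult_ac)
    also have "\<dots> = (\<Sum>r<m. \<Sum>s<m. \<Sum>l\<in>I. \<beta> r * \<beta> s * (c l * (e r l * e s l)))"
      by (subst sum.swap, rule sum.cong[OF refl], rule sum.swap)
    also have "\<dots> = (\<Sum>r<m. \<Sum>s<m. if r = s then (\<beta> r)\<^sup>2 else 0)"
      by (intro sum.cong refl) (simp add: sum_distrib_left[symmetric] on power2_eq_square)
    also have "\<dots> = (\<Sum>r<m. (\<beta> r)\<^sup>2)" by simp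
    finally have Q: "(\<Sum>l\<in>I. c l * (x l)\<^sup>2) = (\<Sum>r<m. (\<beta> r)\<^sup>2)" .
    have "(x i)\<^sup>2 \<le> (\<Sum>r<m. (\<beta> r)\<^sup>2) * (\<Sum>r<m. (e r i)\<^sup>2)"
      unfolding xe[OF i] by (rule Cauchy_Schwarz_ineq_sum)
    from mult_left_mono[OF this less_imp_le[OF c[OF i]]]
    show "c i * (x i)\<^sup>2 \<le> \<tau> i * (\<Sum>l\<in>I. c l * (x l)\<^sup>2)"
      by (simp add: Q \<tau>_def mult_ac)
  next
    show "0 \<le> \<tau> i" if "i \<in> I" for i
      using c[OF that] by (simp add: \<tau>_def sum_nonneg)
    have "(\<Sum>i\<in>I. \<tau> i) = (\<Sum>r<m. \<Sum>i\<in>I. c i * (e r i * e r i))"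
      unfolding \<tau>_def by (subst sum.swap) (simp add: sum_distrib_left power2_eq_square)
    also have "\<dots> = real m" by (simp add: on)
    finally show "(\<Sum>i\<in>I. \<tau> i) \<le> real (card B)" using m by simp
  qed
qed

section \<open>Maximal feasible weights\<close>

text \<open>The constraints are monotone in the weights except for the single entry \<^term>\<open>w i\<close> on the left,
  so the pointwise supremum of all feasible weights is feasible and, as in Knaster-Tarski, a
  non-tight weight below 1 could be increased.\<close>
lemma maximal_weights:
  fixes x :: "'j \<Rightarrow> 'i \<Rightarrow> real" and u \<delta> :: real
  assumes "finite I" "finite J" "0 \<le> u" "0 \<le> \<delta>"
  defines "feas \<equiv> \<lambda>w. (\<forall>i\<in>I. 0 \<le> w i \<and> w i \<le> 1) \<and>
    (\<forall>i\<in>I. \<forall>j\<in>J. w i * (x j i)\<^sup>2 \<le> u * (\<Sum>l\<in>I. (w l + \<delta>) * (x j l)\<^sup>2))"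
  obtains w where "feas w"
    and "\<And>i. i \<in> I \<Longrightarrow> w i < 1 \<Longrightarrow>
      \<exists>j\<in>J. x j i \<noteq> 0 \<and> w i * (x j i)\<^sup>2 = u * (\<Sum>l\<in>I. (w l + \<delta>) * (x j l)\<^sup>2)"
proof -
  \<comment> \<open>Outside \<open>I\<close> the values are unconstrained and this supremum is
    unspecified; feasibility reads \<open>w\<close> only on \<open>I\<close>.\<close>
  define w where "w i = (SUP w'\<in>Collect feas. w' i)" for i
  have f0: "feas (\<lambda>_. 0)"
    using assms by (auto simp: feas_def intro!: mult_nonneg_nonneg sum_nonneg)
  have bdd: "bdd_above ((\<lambda>w'. w' i) ` Collect feas)" if "i \<in> I" for i
    using that by (intro bdd_aboveI[of _ 1]) (auto simp: feas_def)
  have up: "w' i \<le> w i" if "feas w'" "i \<in> I" for w' i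
    unfolding w_def using that bdd by (intro cSUP_upper) auto
  have le: "w i \<le> z" if "\<And>w'. feas w' \<Longrightarrow> w' i \<le> z" for i z
    unfolding w_def using that f0 by (intro cSUP_least) auto
  have mono: "(\<Sum>l\<in>I. (w1 l + \<delta>) * (x j l)\<^sup>2) \<le> (\<Sum>l\<in>I. (w2 l + \<delta>) * (x j l)\<^sup>2)"
    if "\<And>i. i \<in> I \<Longrightarrow> w1 i \<le> w2 i" for w1 w2 j
    using that by (intro sum_mono mult_right_mono) auto
  have fw: "feas w"
    unfolding feas_def
  proof (intro conjI ballI)
    fix i assume i: "i \<in> I"
    show "0 \<le> w i" using up[OF f0 i] by simp
    show "w i \<le> 1" using i by (intro le) (auto simp: feas_def)
    fix j assume j: "j \<in> J"
    have *: "w' i * (x j i)\<^sup>2 \<le> u * (\<Sum>l\<in>I. (w l + \<delta>) * (x j l)\<^sup>2)" if "feas w'" for w'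
    proof -
      have "w' i * (x j i)\<^sup>2 \<le> u * (\<Sum>l\<in>I. (w' l + \<delta>) * (x j l)\<^sup>2)"
        using that i j by (auto simp: feas_def)
      also have "\<dots> \<le> u * (\<Sum>l\<in>I. (w l + \<delta>) * (x j l)\<^sup>2)"
        using up[OF that] \<open>0 \<le> u\<close> by (intro mult_left_mono mono) auto
      finally show ?thesis .
    qed
    show "w i * (x j i)\<^sup>2 \<le> u * (\<Sum>l\<in>I. (w l + \<delta>) * (x j l)\<^sup>2)"
    proof (cases "x j i = 0")
      case True
      then show ?thesis using *[OF f0] by simp
    next
      case False
      \<comment> \<open>Dividing by the square turns \<open>*\<close> into an upper bound on every
        feasible \<open>w' i\<close>, hence on their supremum.\<close>
      then have "w i \<le> u * (\<Sum>l\<in>I. (w l + \<delta>) * (x j l)\<^sup>2) / (x j i)\<^sup>2"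
        using * by (intro le) (simp add: pos_le_divide_eq)
      then show ?thesis using False by (simp add: pos_le_divide_eq)
    qed
  qed
  show thesis
  proof (rule that[OF fw], rule ccontr)
    fix i assume i: "i \<in> I" and w1: "w i < 1"
    assume no: "\<not> (\<exists>j\<in>J. x j i \<noteq> 0 \<and> w i * (x j i)\<^sup>2 = u * (\<Sum>l\<in>I. (w l + \<delta>) * (x j l)\<^sup>2))"
    define R where "R j = u * (\<Sum>l\<in>I. (w l + \<delta>) * (x j l)\<^sup>2)" for j
    have R: "w l * (x j l)\<^sup>2 \<le> R j" if "l \<in> I" "j \<in> J" for l j
      using fw that by (auto simp: feas_def R_def)
    \<comment> \<open>\<open>Z\<close> lists the caps on the weight of \<open>i\<close> while the
      right-hand sides stay at \<open>R\<close>; the element 1 is the cap from the range of weights.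
      Without tightness all caps exceed \<open>w i\<close>, and raising the weight to
      \<open>Min Z\<close> only enlarges the right-hand sides, so feasibility survives.\<close>
    define Z where "Z = insert 1 ((\<lambda>j. R j / (x j i)\<^sup>2) ` {j \<in> J. x j i \<noteq> 0})"
    have fZ: "finite Z" "Z \<noteq> {}" using \<open>finite J\<close> by (auto simp: Z_def)
    have "w i < R j / (x j i)\<^sup>2" if "j \<in> J" "x j i \<noteq> 0" for j
      using R[OF i \<open>j \<in> J\<close>] no that by (fastforce simp: R_def pos_less_divide_eq)
    then have gt: "w i < Min Z" using fZ w1 by (auto simp: Z_def)
    define w' where "w' = w(i := Min Z)"
    have ge: "w l \<le> w' l" for l using gt by (simp add: w'_def)
    have "feas w'"
      unfolding feas_def
    proof (intro conjI ballI)
      fix l assume l: "l \<in> I"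
      show "0 \<le> w' l" using fw l ge[of l] by (fastforce simp: feas_def)
      have "Min Z \<le> 1" using fZ by (intro Min_le) (auto simp: Z_def)
      then show "w' l \<le> 1" using fw l by (auto simp: feas_def w'_def)
      fix j assume j: "j \<in> J"
      have "w' l * (x j l)\<^sup>2 \<le> R j"
      proof (cases "l = i \<and> x j i \<noteq> 0")
        case True
        then have "Min Z \<le> R j / (x j i)\<^sup>2" using fZ j by (intro Min_le) (auto simp: Z_def)
        then show ?thesis using True by (simp add: w'_def pos_le_divide_eq)
      next
        case False
        then show ?thesis using R[OF l j] by (auto simp: w'_def)
      qed
      also have "\<dots> \<le> u * (\<Sum>l\<in>I. (w' l + \<delta>) * (x j l)\<^sup>2)"
        unfolding R_def using \<open>0 \<le> u\<close> ge by (intro mult_left_mono mono) auto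
      finally show "w' l * (x j l)\<^sup>2 \<le> u * (\<Sum>l\<in>I. (w' l + \<delta>) * (x j l)\<^sup>2)" .
    qed
    from up[OF this i] gt show False by (simp add: w'_def)
  qed
qed

text \<open>Maximal weights make every row of weight below 1 tight for some \<open>x j\<close>,
  which forces its leverage score under the weights \<open>w i + \<delta>\<close> to be at least
  \<open>u\<close>. As the scores sum to at most \<open>card B\<close>, there are few such
  rows.\<close>

lemma bounded_leverage_weights:
  fixes x :: "'j \<Rightarrow> 'i \<Rightarrow> real" and v :: "'b \<Rightarrow> 'i \<Rightarrow> real" and a :: "'j \<Rightarrow> 'b \<Rightarrow> real"
  assumes "finite I" "finite J" "finite B" "0 \<le> u" "0 < \<delta>"
    and x: "\<And>j i. j \<in> J \<Longrightarrow> i \<in> I \<Longrightarrow> x j i = (\<Sum>b\<in>B. a j b * v b i)"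
  obtains w where "\<And>i. i \<in> I \<Longrightarrow> 0 \<le> w i" "\<And>i. i \<in> I \<Longrightarrow> w i \<le> 1"
    and "\<And>i j. i \<in> I \<Longrightarrow> j \<in> J \<Longrightarrow> w i * (x j i)\<^sup>2 \<le> u * (\<Sum>l\<in>I. (w l + \<delta>) * (x j l)\<^sup>2)"
    and "u * real (card {i \<in> I. w i < 1}) \<le> real (card B)"
proof -
  obtain w where fw: "(\<forall>i\<in>I. 0 \<le> w i \<and> w i \<le> 1) \<and>
      (\<forall>i\<in>I. \<forall>j\<in>J. w i * (x j i)\<^sup>2 \<le> u * (\<Sum>l\<in>I. (w l + \<delta>) * (x j l)\<^sup>2))"
    and tight: "\<And>i. i \<in> I \<Longrightarrow> w i < 1 \<Longrightarrow>
      \<exists>j\<in>J. x j i \<noteq> 0 \<and> w i * (x j i)\<^sup>2 = u * (\<Sum>l\<in>I. (w l + \<delta>) * (x j l)\<^sup>2)"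
    by (rule maximal_weights[OF \<open>finite I\<close> \<open>finite J\<close> \<open>0 \<le> u\<close> less_imp_le[OF \<open>0 < \<delta>\<close>], of x])
      blast
  have w: "\<And>i. i \<in> I \<Longrightarrow> 0 \<le> w i" "\<And>i. i \<in> I \<Longrightarrow> w i \<le> 1"
    and feas: "\<And>i j. i \<in> I \<Longrightarrow> j \<in> J \<Longrightarrow> w i * (x j i)\<^sup>2 \<le> u * (\<Sum>l\<in>I. (w l + \<delta>) * (x j l)\<^sup>2)"
    using fw by blast+
  have pos: "0 < w i + \<delta>" if "i \<in> I" for i using w(1)[OF that] \<open>0 < \<delta>\<close> by simp
  obtain \<tau> :: "'i \<Rightarrow> real"
    where \<tau>: "\<And>x a i. (\<And>i. i \<in> I \<Longrightarrow> x i = (\<Sum>b\<in>B. a b * v b i)) \<Longrightarrow> i \<in> I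
      \<Longrightarrow> (w i + \<delta>) * (x i)\<^sup>2 \<le> \<tau> i * (\<Sum>l\<in>I. (w l + \<delta>) * (x l)\<^sup>2)"
      and \<tau>0: "\<And>i. i \<in> I \<Longrightarrow> 0 \<le> \<tau> i"
      and sum\<tau>: "(\<Sum>i\<in>I. \<tau> i) \<le> real (card B)"
    using leverage_scores[of I "\<lambda>i. w i + \<delta>" B v] pos assms by blast
  let ?S = "{i \<in> I. w i < 1}"
  have "u \<le> \<tau> i" if i: "i \<in> I" "w i < 1" for i
  proof -
    from tight[OF i] obtain j where j: "j \<in> J" "x j i \<noteq> 0"
      and eq: "w i * (x j i)\<^sup>2 = u * (\<Sum>l\<in>I. (w l + \<delta>) * (x j l)\<^sup>2)" by blast
    let ?Q = "\<Sum>l\<in>I. (w l + \<delta>) * (x j l)\<^sup>2"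
    have "0 < (w i + \<delta>) * (x j i)\<^sup>2" using pos[OF i(1)] j by simp
    also have "\<dots> \<le> ?Q"
      using i \<open>finite I\<close> pos by (intro member_le_sum mult_nonneg_nonneg) (auto simp: less_imp_le)
    finally have Q: "0 < ?Q" .
    \<comment> \<open>Tightness and the leverage bound give
      \<open>u * ?Q \<le> \<tau> i * ?Q\<close>; then \<open>?Q\<close> is cancelled, being positive
      thanks to the ridge \<delta>.\<close>
    have "u * ?Q \<le> (w i + \<delta>) * (x j i)\<^sup>2"
      unfolding eq[symmetric] using \<open>0 < \<delta>\<close> by (intro mult_right_mono) auto
    also have "\<dots> \<le> \<tau> i * ?Q"
      using x[OF j(1)] i by (intro \<tau>) auto
    finally show ?thesis using Q by simp
  qed
  then have "(\<Sum>i\<in>?S. u) \<le> (\<Sum>i\<in>?S. \<tau> i)" by (intro sum_mono) auto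
  also have "\<dots> \<le> (\<Sum>i\<in>I. \<tau> i)" using \<open>finite I\<close> \<tau>0 by (intro sum_mono2) auto
  finally have "u * real (card ?S) \<le> real (card B)" using sum\<tau> by (simp add: mult.commute)
  with w feas that show thesis by blast
qed


section \<open>Choosing the rows to delete\<close>

text \<open>The combinatorial core for \<epsilon> strictly between 0 and 1, with denominators
  cleared. \<open>Z j\<close> stands for the zero positions of the mask in column \<open>j\<close>,
  and \<open>card B\<close> for the rank.\<close>

lemma exists_sparsifying_rows:
  fixes x :: "'j \<Rightarrow> 'i \<Rightarrow> real" and v :: "'b \<Rightarrow> 'i \<Rightarrow> real" and a :: "'j \<Rightarrow> 'b \<Rightarrow> real"
  assumes "finite I" "finite J" "finite B" "0 < \<epsilon>" "\<epsilon> < 1"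
    and x: "\<And>j i. j \<in> J \<Longrightarrow> i \<in> I \<Longrightarrow> x j i = (\<Sum>b\<in>B. a j b * v b i)"
    and Z: "\<And>j. j \<in> J \<Longrightarrow> Z j \<subseteq> I" "\<And>j. j \<in> J \<Longrightarrow> card (Z j) \<le> t"
  shows "\<exists>S\<subseteq>I. \<epsilon> * real (card S) \<le> real t * real (card B) \<and>
    (1 - \<epsilon>) * (\<Sum>j\<in>J. \<Sum>i\<in>Z j - S. (x j i)\<^sup>2) \<le> \<epsilon> * (\<Sum>j\<in>J. \<Sum>i\<in>I - Z j. (x j i)\<^sup>2)"
proof (cases "t = 0")
  case True
  have "Z j = {}" if "j \<in> J" for j
    using Z[OF that] True \<open>finite I\<close> finite_subset by fastforce
  then show ?thesis
    using \<open>0 < \<epsilon>\<close> by (intro exI[of _ "{}"]) (auto intro!: mult_nonneg_nonneg sum_nonneg)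
next
  case False
  \<comment> \<open>Each of the at most \<open>t\<close> weighted entries in \<open>Z j\<close> is
    at most \<open>u\<close> times the column total, so together they take at most the fraction
    \<epsilon>.\<close>
  define u where "u = \<epsilon> / real t"
  have u: "0 \<le> u" "real t * u = \<epsilon>" using False \<open>0 < \<epsilon>\<close> by (auto simp: u_def)
  define A where "A = {S. S \<subseteq> I \<and> \<epsilon> * real (card S) \<le> real t * real (card B)}"
  define F where "F S = (1 - \<epsilon>) * (\<Sum>j\<in>J. \<Sum>i\<in>Z j - S. (x j i)\<^sup>2)" for S
  define R where "R = (\<Sum>j\<in>J. \<Sum>i\<in>I - Z j. (x j i)\<^sup>2)"
  define T where "T = (\<Sum>j\<in>J. \<Sum>i\<in>I. (x j i)\<^sup>2)"
  \<comment> \<open>For fixed \<delta> the ridge costs an error proportional to \<open>T\<close>,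
    the total squared mass.\<close>
  have approx: "\<exists>S\<in>A. F S \<le> \<epsilon> * (R + \<delta> * T)" if "0 < \<delta>" for \<delta>
  proof -
    obtain w where w: "\<And>i. i \<in> I \<Longrightarrow> 0 \<le> w i" "\<And>i. i \<in> I \<Longrightarrow> w i \<le> 1"
      and feas: "\<And>i j. i \<in> I \<Longrightarrow> j \<in> J \<Longrightarrow> w i * (x j i)\<^sup>2 \<le> u * (\<Sum>l\<in>I. (w l + \<delta>) * (x j l)\<^sup>2)"
      and cS: "u * real (card {i \<in> I. w i < 1}) \<le> real (card B)"
      using bounded_leverage_weights[of I J B u \<delta> x a v] assms(1-3) u(1) \<open>0 < \<delta>\<close> x by blast
    define S where "S = {i \<in> I. w i < 1}"
    have "real t * (u * real (card S)) \<le> real t * real (card B)"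
      using cS unfolding S_def by (intro mult_left_mono) auto
    then have "S \<in> A" using u(2) by (simp add: A_def S_def mult.assoc[symmetric])
    moreover have "(1 - \<epsilon>) * (\<Sum>i\<in>Z j - S. (x j i)\<^sup>2)
        \<le> \<epsilon> * ((\<Sum>i\<in>I - Z j. (x j i)\<^sup>2) + \<delta> * (\<Sum>i\<in>I. (x j i)\<^sup>2))" if j: "j \<in> J" for j
    proof -
      note Zj = Z[OF j]
      have fZ: "finite (Z j)" using Zj \<open>finite I\<close> finite_subset by blast
      define P where "P = (\<Sum>i\<in>Z j. w i * (x j i)\<^sup>2)"
      define P' where "P' = (\<Sum>i\<in>I - Z j. w i * (x j i)\<^sup>2)"
      define Q where "Q = (\<Sum>l\<in>I. (w l + \<delta>) * (x j l)\<^sup>2)"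
      have Q: "Q = P + P' + \<delta> * (\<Sum>i\<in>I. (x j i)\<^sup>2)"
        using sum.subset_diff[OF Zj(1) \<open>finite I\<close>, of "\<lambda>i. w i * (x j i)\<^sup>2"]
        by (simp add: Q_def P_def P'_def distrib_right sum.distrib sum_distrib_left)
      have Q0: "0 \<le> Q"
        unfolding Q_def using w \<open>0 < \<delta>\<close> by (intro sum_nonneg mult_nonneg_nonneg) (auto intro: add_nonneg_nonneg)
      have "P \<le> real (card (Z j)) * (u * Q)"
        unfolding P_def Q_def using Zj(1) j by (intro sum_bounded_above feas) auto
      also have "\<dots> \<le> real t * (u * Q)"
        using Zj(2) u Q0 by (intro mult_right_mono) auto
      also have "\<dots> = \<epsilon> * Q" using u(2) by (simp add: mult.assoc[symmetric])
      finally have P: "P \<le> \<epsilon> * Q" .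
      have P': "P' \<le> (\<Sum>i\<in>I - Z j. (x j i)\<^sup>2)"
        unfolding P'_def using w by (intro sum_mono mult_left_le_one_le) auto
      have "(\<Sum>i\<in>Z j - S. (x j i)\<^sup>2) = (\<Sum>i\<in>Z j - S. w i * (x j i)\<^sup>2)"
      proof (rule sum.cong[OF refl])
        fix i assume i: "i \<in> Z j - S"
        then have "w i = 1" using Zj(1) w(2)[of i] by (force simp: S_def)
        then show "(x j i)\<^sup>2 = w i * (x j i)\<^sup>2" by simp
      qed
      also have "\<dots> \<le> P"
        unfolding P_def using fZ Zj(1) w(1) by (intro sum_mono2) (auto intro!: mult_nonneg_nonneg)
      finally have "(1 - \<epsilon>) * (\<Sum>i\<in>Z j - S. (x j i)\<^sup>2) \<le> (1 - \<epsilon>) * P"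
        using \<open>\<epsilon> < 1\<close> by (intro mult_left_mono) auto
      \<comment> \<open>This is \<open>P \<le> \<epsilon> * Q\<close> with \<open>Q\<close> expanded
        and the term \<open>\<epsilon> * P\<close> moved to the left.\<close>
      also have "\<dots> \<le> \<epsilon> * (P' + \<delta> * (\<Sum>i\<in>I. (x j i)\<^sup>2))"
        using P by (simp add: Q algebra_simps)
      also have "\<dots> \<le> \<epsilon> * ((\<Sum>i\<in>I - Z j. (x j i)\<^sup>2) + \<delta> * (\<Sum>i\<in>I. (x j i)\<^sup>2))"
        using P' \<open>0 < \<epsilon>\<close> by (intro mult_left_mono add_right_mono) auto
      finally show ?thesis .
    qed
    then have "(\<Sum>j\<in>J. (1 - \<epsilon>) * (\<Sum>i\<in>Z j - S. (x j i)\<^sup>2))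
        \<le> (\<Sum>j\<in>J. \<epsilon> * ((\<Sum>i\<in>I - Z j. (x j i)\<^sup>2) + \<delta> * (\<Sum>i\<in>I. (x j i)\<^sup>2)))"
      by (rule sum_mono)
    then have "F S \<le> \<epsilon> * (R + \<delta> * T)"
      by (simp add: F_def R_def T_def sum_distrib_left[symmetric] sum.distrib)
    ultimately show ?thesis by blast
  qed
  have A: "finite A" "A \<noteq> {}"
    using \<open>finite I\<close> approx[of 1] by (auto simp: A_def)
  \<comment> \<open>Only finitely many \<open>S\<close> are admissible, so one minimizer of \<open>F\<close> works for every \<open>\<delta>\<close>.\<close>
  define S where "S = arg_min_on F A"
  have S: "S \<in> A" unfolding S_def by (rule arg_min_if_finite(1)[OF A])
  have T: "0 \<le> T" unfolding T_def by (intro sum_nonneg) auto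
  have "F S \<le> \<epsilon> * R + d" if "0 < d" for d
  proof -
    \<comment> \<open>With this choice the error \<open>\<epsilon> * \<delta> * T\<close> equals
      \<open>d * T / (T + 1)\<close>, at most \<open>d\<close>; adding 1 avoids division by
      zero.\<close>
    define \<delta> where "\<delta> = d / (\<epsilon> * (T + 1))"
    have "0 < \<delta>" using that T \<open>0 < \<epsilon>\<close> by (simp add: \<delta>_def)
    from approx[OF this] obtain S' where S': "S' \<in> A" "F S' \<le> \<epsilon> * (R + \<delta> * T)" by blast
    have "F S \<le> F S'" unfolding S_def by (rule arg_min_least[OF A S'(1)])
    also have "\<dots> \<le> \<epsilon> * R + \<epsilon> * \<delta> * T" using S'(2) by (simp add: algebra_simps)
    also have "\<epsilon> * \<delta> * T \<le> d"
      using that T \<open>0 < \<epsilon>\<close> by (simp add: \<delta>_def divide_simps)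
    finally show ?thesis by simp
  qed
  then have "F S \<le> \<epsilon> * R" by (rule field_le_epsilon)
  with S show ?thesis by (auto simp: A_def F_def R_def)
qed

section \<open>Rank factorization and Frobenius norms of submatrices\<close>

text \<open>\<open>B\<close> is a maximal independent set of columns: by maximality it spans every
  column, and its size is the rank. The coordinates of column \<open>j\<close> form
  \<open>a j\<close>.\<close>

lemma (in vec_space) rank_factorization:
  assumes "A \<in> carrier_mat n p"
  obtains B a where "finite B" "card B = rank A"
    and "\<And>i j. i < n \<Longrightarrow> j < p \<Longrightarrow> A $$ (i, j) = (\<Sum>b\<in>B. a j b * b $ i)"
proof -
  let ?C = "set (cols A)"
  have C: "?C \<subseteq> carrier_vec n" using cols_dim assms by blast
  obtain U where U: "finite U" "maximal U (\<lambda>T. T \<subseteq> ?C \<and> lin_indpt T)"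
    using maximal_exists_superset[of ?C "\<lambda>T. T \<subseteq> ?C \<and> lin_indpt T" "{}"]
    by (auto simp: finite_lin_indpt2)
  then have UC: "U \<subseteq> ?C" and ind: "lin_indpt U" by (auto simp: maximal_def)
  have UV: "U \<subseteq> carrier_vec n" using UC C by blast
  have "s \<in> span U" if s: "s \<in> ?C" for s
  proof (rule ccontr)
    assume ns: "s \<notin> span U"
    then have "lin_indpt (U \<union> {s})"
      using lin_dep_iff_in_span[of U s] UV ind s C span_mem[OF UV] by auto
    then have "U \<union> {s} = U"
      using U(2) UC s unfolding maximal_def by blast
    then show False using ns span_mem[OF UV] by auto
  qed
  then have "\<forall>j. \<exists>a. j < p \<longrightarrow> col A j = lincomb a U"
    using finite_span[OF U(1) UV] assms by (fastforce simp: cols_def)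
  then obtain a where a: "\<And>j. j < p \<Longrightarrow> col A j = lincomb (a j) U" by metis
  show thesis
  proof (rule that[OF U(1) rank_card_indpt[OF assms U(2), symmetric]])
    fix i j assume ij: "i < n" "j < p"
    then have "A $$ (i, j) = col A j $ i" using assms by simp
    then show "A $$ (i, j) = (\<Sum>b\<in>U. a j b * b $ i)"
      using a[OF ij(2)] lincomb_index[OF ij(1) UV] by simp
  qed
qed

lemma bij_betw_pick:
  assumes "finite R"
  shows "bij_betw (pick R) {..<card R} R"
proof -
  have "inj_on (pick R) {..<card R}"
    by (rule inj_onI) (metis lessThan_iff nat_neq_iff pick_mono_le)
  moreover have "pick R ` {..<card R} \<subseteq> R" using pick_in_set_le by auto
  ultimately show ?thesis
    using assms by (simp add: bij_betw_def card_image card_subset_eq)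
qed

lemma frob_norm_sq: "(frob_norm A)\<^sup>2 = (\<Sum>i<dim_row A. \<Sum>j<dim_col A. (A $$ (i, j))\<^sup>2)"
  unfolding frob_norm_def by (intro real_sqrt_pow2 sum_nonneg) auto

text \<open>\<open>submatrix\<close> renumbers its rows and columns through \<open>pick\<close>,
  which enumerates an index set bijectively; reindexing restores sums over the original
  indices.\<close>

lemma frob_norm_sq_submatrix:
  assumes A: "A \<in> carrier_mat n p" "B \<in> carrier_mat n p" and R: "R \<subseteq> {..<n}"
  shows "(frob_norm (entrywise_prod (submatrix A R {..<p}) (one_minus_mat (submatrix B R {..<p}))))\<^sup>2
    = (\<Sum>i\<in>R. \<Sum>j<p. (A $$ (i, j) * (1 - B $$ (i, j)))\<^sup>2)"
proof -
  let ?f = "\<lambda>i j. (A $$ (i, j) * (1 - B $$ (i, j)))\<^sup>2"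
  have fin: "finite R" using R finite_subset by blast
  have rows: "{i. i < n \<and> i \<in> R} = R" using R by auto
  have cols: "{j. j < p \<and> j \<in> {..<p}} = {..<p}" by auto
  have "(frob_norm (entrywise_prod (submatrix A R {..<p}) (one_minus_mat (submatrix B R {..<p}))))\<^sup>2
    = (\<Sum>i<card R. \<Sum>j<p. ?f (pick R i) (pick {..<p} j))"
    using A by (simp add: frob_norm_sq entrywise_prod_def one_minus_mat_def submatrix_def rows cols)
  also have "\<dots> = (\<Sum>i<card R. \<Sum>j<p. ?f (pick R i) j)"
  proof (rule sum.cong[OF refl])
    fix r
    show "(\<Sum>j<p. ?f (pick R r) (pick {..<p} j)) = (\<Sum>j<p. ?f (pick R r) j)"
      using sum.reindex_bij_betw[OF bij_betw_pick[of "{..<p}"], of "?f (pick R r)"] by simp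
  qed
  also have "\<dots> = (\<Sum>i\<in>R. \<Sum>j<p. ?f i j)"
    by (rule sum.reindex_bij_betw[OF bij_betw_pick[OF fin]])
  finally show ?thesis .
qed

(* Rows and columns are indexed from 0. The two bounds are stated in the extended reals, where
   c / 0 = \<infinity> for c > 0 and 0 / 0 = \<infinity> * 0 = 0, so that the endpoints \<epsilon> = 0 and \<epsilon> = 1
   have their usual meaning (the division of real numbers would give c / 0 = 0 instead). *)
theorem theorem17:
  fixes W L :: "real mat" and n p t k :: nat and \<epsilon> :: real
  assumes "W \<in> carrier_mat n p"
    and "\<forall>i<n. \<forall>j<p. W $$ (i, j) \<in> {0, 1}"
    and "\<forall>j<p. card {i. i < n \<and> W $$ (i, j) = 0} \<le> t"
    and "L \<in> carrier_mat n p"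
    and "vec_space.rank n L = k"
    and "0 \<le> \<epsilon>" and "\<epsilon> \<le> 1"
  shows "\<exists>S \<subseteq> {..<n}.
    ereal (real (card S)) \<le> ereal (real t * real k) / ereal \<epsilon> \<and>
    (let W' = submatrix W ({..<n} - S) {..<p};
         L' = submatrix L ({..<n} - S) {..<p}
     in ereal ((frob_norm (entrywise_prod L' (one_minus_mat W')))\<^sup>2)
          \<le> ereal \<epsilon> / ereal (1 - \<epsilon>) * ereal ((frob_norm (entrywise_prod L W))\<^sup>2))"
proof -
  obtain B :: "real vec set" and a where B: "finite B" "card B = k"
    and La: "\<And>i j. i < n \<Longrightarrow> j < p \<Longrightarrow> L $$ (i, j) = (\<Sum>b\<in>B. a j b * b $ i)"
    using vec_space.rank_factorization[OF assms(4)] assms(5) by blast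
  define Z where "Z j = {i. i < n \<and> W $$ (i, j) = 0}" for j
  \<comment> \<open>\<open>F S\<close> and \<open>R\<close> are the two squared norms of the claim,
    summed column by column: \<open>1 - W\<close> is the indicator of \<open>Z j\<close> in column
    \<open>j\<close>, and \<open>W\<close> that of its complement.\<close>
  define F where "F S = (\<Sum>j<p. \<Sum>i\<in>Z j - S. (L $$ (i, j))\<^sup>2)" for S
  define R where "R = (\<Sum>j<p. \<Sum>i\<in>{..<n} - Z j. (L $$ (i, j))\<^sup>2)"
  have fZ: "finite (Z j)" for j by (simp add: Z_def)
  have F0: "0 \<le> F S" for S unfolding F_def by (intro sum_nonneg) auto
  have R0: "0 \<le> R" unfolding R_def by (intro sum_nonneg) auto
  have W01: "W $$ (i, j) = (if i \<in> Z j then 0 else 1)" if "i < n" "j < p" for i j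
    using assms(2) that by (auto simp: Z_def)
  have normL: "(frob_norm (entrywise_prod (submatrix L ({..<n} - S) {..<p})
      (one_minus_mat (submatrix W ({..<n} - S) {..<p}))))\<^sup>2 = F S" for S
  proof -
    have "(\<Sum>i\<in>{..<n} - S. (L $$ (i, j) * (1 - W $$ (i, j)))\<^sup>2) = (\<Sum>i\<in>Z j - S. (L $$ (i, j))\<^sup>2)"
      if "j < p" for j
      using that by (intro sum.mono_neutral_cong_right) (auto simp: W01, auto simp: Z_def)
    then show ?thesis
      by (subst frob_norm_sq_submatrix[OF assms(4,1)], force, subst sum.swap) (simp add: F_def)
  qed
  have normR: "(frob_norm (entrywise_prod L W))\<^sup>2 = R"
  proof -
    have "(\<Sum>i<n. (L $$ (i, j) * W $$ (i, j))\<^sup>2) = (\<Sum>i\<in>{..<n} - Z j. (L $$ (i, j))\<^sup>2)"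
      if "j < p" for j
      using that by (intro sum.mono_neutral_cong_right) (auto simp: W01)
    moreover have "(frob_norm (entrywise_prod L W))\<^sup>2 = (\<Sum>i<n. \<Sum>j<p. (L $$ (i, j) * W $$ (i, j))\<^sup>2)"
      using assms(1,4) by (simp add: frob_norm_sq entrywise_prod_def)
    ultimately show ?thesis by (subst (asm) sum.swap) (simp add: R_def)
  qed
  have main: "\<exists>S\<subseteq>{..<n}. \<eta> * real (card S) \<le> real t * real k \<and> (1 - \<eta>) * F S \<le> \<eta> * R"
    if "0 < \<eta>" "\<eta> < 1" for \<eta>
    unfolding F_def R_def B(2)[symmetric]
    using assms(3) that
    by (intro exists_sparsifying_rows[where a = a and v = "\<lambda>b i. b $ i"])
      (auto simp: B(1) La Z_def)
  have "\<exists>S\<subseteq>{..<n}. ereal (real (card S)) \<le> ereal (real t * real k) / ereal \<epsilon> \<and>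
      ereal (F S) \<le> ereal \<epsilon> / ereal (1 - \<epsilon>) * ereal R"
  proof -
    consider "\<epsilon> = 0" "t * k = 0" | "\<epsilon> = 0" "0 < t * k" | "0 < \<epsilon>" "\<epsilon> < 1" | "\<epsilon> = 1"
      using assms(6,7) by fastforce
    then show ?thesis
    proof cases
      case 1
      \<comment> \<open>Here no row may be deleted. If \<open>k = 0\<close> then \<open>L\<close>
        vanishes, as \<open>B\<close> is empty; otherwise \<open>t = 0\<close> and \<open>W\<close>
        has no zeros.\<close>
      have "(L $$ (i, j))\<^sup>2 = 0" if "j < p" "i \<in> Z j" for i j
      proof (cases "k = 0")
        case True
        then show ?thesis using La[of i j] B that by (simp add: Z_def)
      next
        case False
        then have "card (Z j) = 0" using 1(2) assms(3) that(1) by (force simp: Z_def)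
        then show ?thesis using fZ that(2) by auto
      qed
      then have "F {} = 0" by (simp add: F_def)
      then show ?thesis by (intro exI[of _ "{}"]) (use 1 in simp)
    next
      case 2
      \<comment> \<open>The size bound is infinite here, so all rows may be deleted.\<close>
      have "F {..<n} = 0" unfolding F_def by (intro sum.neutral ballI) (auto simp: Z_def)
      then show ?thesis using 2 by (intro exI[of _ "{..<n}"]) (auto simp: divide_ereal_def)
    next
      case 3
      from main[OF this] obtain S where S: "S \<subseteq> {..<n}" "\<epsilon> * real (card S) \<le> real t * real k"
        "(1 - \<epsilon>) * F S \<le> \<epsilon> * R" by blast
      have "real (card S) \<le> real t * real k / \<epsilon>" "F S \<le> \<epsilon> / (1 - \<epsilon>) * R"
        using S 3 by (simp_all add: field_simps)
      then show ?thesis using S(1) 3 by (intro exI[of _ S]) simp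
    next
      case 4
      define q where "q = real t * real k"
      have q: "0 \<le> q" by (simp add: q_def)
      \<comment> \<open>\<open>\<eta>\<close> is so close to 1 that the integer \<open>card S\<close> is at most \<open>q\<close> once it is at most \<open>q / \<eta>\<close>.\<close>
      define \<eta> where "\<eta> = (q + 1) / (q + 2)"
      have \<eta>: "0 < \<eta>" "\<eta> < 1" using q by (auto simp: \<eta>_def)
      from main[OF this] obtain S where S: "S \<subseteq> {..<n}" "\<eta> * real (card S) \<le> q"
        "(1 - \<eta>) * F S \<le> \<eta> * R" unfolding q_def by blast
      \<comment> \<open>Since \<open>q * (q + 2)\<close> is one less than the square of
        \<open>q + 1\<close>, \<open>card S\<close> is below \<open>q + 1\<close>, and
        \<open>q\<close> is the integer \<open>t * k\<close>.\<close>
      have "real (card S) * (q + 1) \<le> q * (q + 2)"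
        using S(2) q by (simp add: \<eta>_def field_simps)
      also have "\<dots> < (q + 1) * (q + 1)" by (simp add: algebra_simps)
      finally have "real (card S) < q + 1" using q by simp
      also have "q + 1 = real (t * k + 1)" by (simp add: q_def)
      finally have "card S \<le> t * k" unfolding of_nat_less_iff by simp
      then have cS: "real (card S) \<le> real t * real k"
        unfolding of_nat_mult[symmetric] of_nat_le_iff .
      \<comment> \<open>For \<open>R > 0\<close> the right-hand side is infinite. For
        \<open>R = 0\<close> it is 0, and the bound at \<eta> already forces \<open>F S\<close> to
        vanish.\<close>
      have "ereal (F S) \<le> ereal 1 / ereal 0 * ereal R"
      proof (cases "R = 0")
        case True
        then have "F S \<le> 0" using S(3) \<eta> by (simp add: mult_le_0_iff)
        then show ?thesis using F0[of S] True by simp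
      next
        case False
        then show ?thesis using R0 by (simp add: divide_ereal_def)
      qed
      then show ?thesis using S(1) cS 4 by (intro exI[of _ S]) simp
    qed
  qed
  then show ?thesis by (simp add: Let_def normL normR)
qed

end
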